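(* Let $p$ be an odd prime with $p \neq 7$ and such that $p \bmod 28$ is not one of $3, 19, 27$. Then the Markoff graph mod $p$ is not planar.
   Context: For a prime $p$, define maps $m_1, m_2, m_3 : \mathbb{F}_p^3 \to \mathbb{F}_p^3$ by $m_1(x,y,z) = (yz-x,y,z)$, $m_2(x,y,z) = (x,xz-y,z)$, $m_3(x,y,z) = (x,y,xy-z)$. These are involutions preserving the polynomial $x^2+y^2+z^2-xyz$. The Markoff graph mod $p$ is the graph whose vertices are the triples $(x,y,z) \in \mathbb{F}_p^3$ with $(x,y,z)\neq(0,0,0)$ and $x^2+y^2+z^2=xyz$ in $\mathbb{F}_p$, with an (undirected) edge joining each vertex $v$ to $m_j(v)$ for $j=1,2,3$. If $m_j(v)=v$ this edge is a self-edge (loop) at $v$; loops do not affect planarity. A graph is planar if it can be drawn in the plane without edges crossing. *)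

theory Defs
  imports "HOL-Number_Theory.Residues" "HOL-Analysis.Path_Connected"
begin

(* An undirected multigraph, loops and parallel edges allowed: ends G e is the set of end
   vertices of the edge e, a singleton exactly when e is a loop. *)
record ('a, 'e) multigraph =
  verts :: "'a set"
  edges :: "'e set"
  ends :: "'e \<Rightarrow> 'a set"

(* A drawing of G in the plane, identified with the complex numbers: f places the vertices and
   g draws the edges.  A simple_path may be closed, so a non-loop edge is drawn as an arc (its
   end points are distinct, f being injective) and a loop as a simple closed curve through its
   vertex.  A curve passes through no vertices other than its own end vertices, and two
   distinct curves meet only at the images of common end vertices. *)
definition plane_drawing ::
    "('a, 'e) multigraph \<Rightarrow> ('a \<Rightarrow> complex) \<Rightarrow> ('e \<Rightarrow> real \<Rightarrow> complex) \<Rightarrow> bool" where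
  "plane_drawing G f g \<longleftrightarrow>
     inj_on f (verts G) \<and>
     (\<forall>e\<in>edges G. simple_path (g e) \<and>
        {pathstart (g e), pathfinish (g e)} = f ` ends G e \<and>
        path_image (g e) \<inter> f ` verts G = f ` ends G e) \<and>
     (\<forall>e\<in>edges G. \<forall>e'\<in>edges G. e \<noteq> e' \<longrightarrow>
        path_image (g e) \<inter> path_image (g e') = f ` (ends G e \<inter> ends G e'))"

definition planar :: "('a, 'e) multigraph \<Rightarrow> bool" where
  "planar G \<longleftrightarrow> (\<exists>f g. plane_drawing G f g)"

fun markoff_m1 :: "('a, 'm) ring_scheme \<Rightarrow> 'a \<times> 'a \<times> 'a \<Rightarrow> 'a \<times> 'a \<times> 'a" where
  "markoff_m1 R (x, y, z) = (y \<otimes>\<^bsub>R\<^esub> z \<ominus>\<^bsub>R\<^esub> x, y, z)"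

fun markoff_m2 :: "('a, 'm) ring_scheme \<Rightarrow> 'a \<times> 'a \<times> 'a \<Rightarrow> 'a \<times> 'a \<times> 'a" where
  "markoff_m2 R (x, y, z) = (x, x \<otimes>\<^bsub>R\<^esub> z \<ominus>\<^bsub>R\<^esub> y, z)"

fun markoff_m3 :: "('a, 'm) ring_scheme \<Rightarrow> 'a \<times> 'a \<times> 'a \<Rightarrow> 'a \<times> 'a \<times> 'a" where
  "markoff_m3 R (x, y, z) = (x, y, x \<otimes>\<^bsub>R\<^esub> y \<ominus>\<^bsub>R\<^esub> z)"

definition markoff_triples :: "('a, 'm) ring_scheme \<Rightarrow> ('a \<times> 'a \<times> 'a) set" where
  "markoff_triples R = {(x, y, z). x \<in> carrier R \<and> y \<in> carrier R \<and> z \<in> carrier R \<and>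
     (x, y, z) \<noteq> (\<zero>\<^bsub>R\<^esub>, \<zero>\<^bsub>R\<^esub>, \<zero>\<^bsub>R\<^esub>) \<and>
     x [^]\<^bsub>R\<^esub> (2::nat) \<oplus>\<^bsub>R\<^esub> y [^]\<^bsub>R\<^esub> (2::nat) \<oplus>\<^bsub>R\<^esub> z [^]\<^bsub>R\<^esub> (2::nat) =
       x \<otimes>\<^bsub>R\<^esub> y \<otimes>\<^bsub>R\<^esub> z}"

(* The edge (j, {v, m_j v}) carries its label j, so that edges for different j stay distinct
   even when they are loops at the same vertex.  As m_j is an involution, v and m_j v give the
   same edge. *)
definition markoff_graph ::
    "('a, 'm) ring_scheme \<Rightarrow> ('a \<times> 'a \<times> 'a, nat \<times> ('a \<times> 'a \<times> 'a) set) multigraph" where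
  "markoff_graph R =
     \<lparr>verts = markoff_triples R,
      edges = (\<Union>v\<in>markoff_triples R.
        {(1, {v, markoff_m1 R v}), (2, {v, markoff_m2 R v}), (3, {v, markoff_m3 R v})}),
      ends = snd\<rparr>"

end

theory Submission
  imports Defs "HOL-Analysis.Jordan_Curve" "HOL-Number_Theory.Quadratic_Reciprocity"
begin

text \<open>
  The hypothesis on \<open>p\<close> says that -1 or -7 is a square modulo \<open>p\<close>. In both cases the Markoff graph contains
  an explicit subdivision of the complete bipartite graph on 3 + 3 vertices.

  If -7 is a square, let \<open>z\<close> and \<open>z'\<close> be the roots of \<open>X\<^sup>2 - X + 2\<close> modulo \<open>p\<close>. The permutations of
  \<open>(-1, -1, z)\<close>, \<open>(-1, -1, z')\<close> and \<open>(-1, z, z')\<close> form a cycle of length 12, and the three edges between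
  \<open>(-1, -1, z)\<close> and \<open>(-1, -1, z')\<close> and their permutations are long diagonals of this cycle
  (\<open>markoff_not_planar_if_sqrt_minus_7\<close>).

  If -1 is a square, the triples with first coordinate 2 form a cycle of length \<open>2 p\<close>, and so do those
  with first coordinate -2. Four edges join the two cycles, and their ends follow each other in different
  cyclic orders on the two cycles. Such a twisted prism contains the required subdivision
  (\<open>markoff_not_planar_if_sqrt_minus_1\<close>).

  That a subdivided complete bipartite graph on 3 + 3 vertices has no plane drawing
  (\<open>K33_subdivision_not_planar\<close>) rests on the Jordan curve theorem for theta curves. Six of the nine drawn
  edges form a Jordan curve and the other three are chords of it. Any two of these chords
  have interlaced ends, so they cannot lie on the same side of the curve without crossing
  (\<open>no_crossing_chord_inside\<close>, \<open>no_crossing_chord_outside\<close>), but a curve has only two sides for three chords.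
\<close>

section \<open>Chords of a Jordan curve\<close>

text \<open>
  The chord \<open>c\<close> splits the inside of the closed curve \<open>c1 \<union> c2\<close> into two disjoint open pieces, bounded by
  \<open>c1 \<union> c\<close> and by \<open>c2 \<union> c\<close>. A connected set that avoids \<open>c\<close> stays in one piece, so its closure
  cannot reach the interior of the arc on the other side. The set \<open>D\<close> stands for a second chord without
  its end points \<open>u\<close> and \<open>v\<close>; taking these as limit points keeps the statement easy to transport along a map.
\<close>

lemma no_crossing_chord_inside:
  fixes c :: "real \<Rightarrow> complex"
  assumes c1: "simple_path c1" "pathstart c1 = a" "pathfinish c1 = b"
    and c2: "simple_path c2" "pathstart c2 = a" "pathfinish c2 = b"
    and c: "simple_path c" "pathstart c = a" "pathfinish c = b"
    and "a \<noteq> b"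
    and meets: "path_image c1 \<inter> path_image c2 = {a, b}"
      "path_image c1 \<inter> path_image c = {a, b}"
      "path_image c2 \<inter> path_image c = {a, b}"
    and c_in: "path_image c - {a, b} \<subseteq> inside (path_image c1 \<union> path_image c2)"
    and D: "connected D" "D \<inter> path_image c = {}"
      "D \<subseteq> inside (path_image c1 \<union> path_image c2)"
    and u: "u \<in> closure D" "u \<in> path_image c1 - {a, b}"
    and v: "v \<in> closure D" "v \<in> path_image c2 - {a, b}"
  shows False
proof -
  let ?I1 = "inside (path_image c1 \<union> path_image c)"
  let ?I2 = "inside (path_image c2 \<union> path_image c)"
  have "c (1/2) \<in> path_image c - {a, b}"
    using simple_path_endless[OF c(1)] c(2,3) by auto
  then have ne: "path_image c \<inter> inside (path_image c1 \<union> path_image c2) \<noteq> {}"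
    using c_in by blast
  obtain disj: "?I1 \<inter> ?I2 = {}"
    and split: "?I1 \<union> ?I2 \<union> (path_image c - {a, b}) = inside (path_image c1 \<union> path_image c2)"
    by (rule split_inside_simple_closed_curve[OF c1 c2 c \<open>a \<noteq> b\<close> meets ne])
  have closed: "closed (path_image c1 \<union> path_image c)" "closed (path_image c2 \<union> path_image c)"
    using c1(1) c2(1) c(1) by (auto simp: closed_simple_path_image)
  have "D \<subseteq> ?I1 \<union> ?I2"
    using D(2,3) split by blast
  then have "D \<subseteq> ?I1 \<or> D \<subseteq> ?I2"
    using connectedD[OF D(1) open_inside[OF closed(1)] open_inside[OF closed(2)]] disj
    by blast
  then show False
  proof
    assume "D \<subseteq> ?I1"
    then have "v \<in> ?I1 \<union> (path_image c1 \<union> path_image c)"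
      using closure_mono[of D ?I1] closure_inside_subset[OF closed(1)] v(1) by blast
    moreover have "v \<notin> inside (path_image c1 \<union> path_image c2)"
      using inside_no_overlap[of "path_image c1 \<union> path_image c2"] v(2) by blast
    ultimately show False
      using v(2) meets split by blast
  next
    assume "D \<subseteq> ?I2"
    then have "u \<in> ?I2 \<union> (path_image c2 \<union> path_image c)"
      using closure_mono[of D ?I2] closure_inside_subset[OF closed(2)] u(1) by blast
    moreover have "u \<notin> inside (path_image c1 \<union> path_image c2)"
      using inside_no_overlap[of "path_image c1 \<union> path_image c2"] u(2) by blast
    ultimately show False
      using u(2) meets split by blast
  qed
qed

text \<open>
  Inversion at a point \<open>w\<^sub>0\<close> inside \<open>C\<close> exchanges \<open>w\<^sub>0\<close> with infinity. A path from the image of an outside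
  point to infinity that avoids the image of \<open>C\<close> would pull back to a path from that outside point to
  \<open>w\<^sub>0\<close> avoiding \<open>C\<close>. The point 0, which corresponds to infinity in the source, must be kept off the path;
  deleting it from the open connected outside of the image leaves a connected set.
\<close>

lemma inversion_maps_outside_to_inside:
  fixes C :: "complex set" and w\<^sub>0 :: complex
  defines "\<psi> \<equiv> \<lambda>w. inverse (w - w\<^sub>0)"
  assumes "compact C" "w\<^sub>0 \<in> inside C"
  shows "\<psi> ` outside C \<subseteq> inside (\<psi> ` C)"
proof
  fix y assume "y \<in> \<psi> ` outside C"
  then obtain x where x: "x \<in> outside C" "y = \<psi> x" by blast
  have w0: "w\<^sub>0 \<notin> C" "w\<^sub>0 \<notin> outside C"
    using assms inside_no_overlap[of C] inside_Int_outside[of C] by blast+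
  have inj: "\<psi> u = \<psi> v \<longleftrightarrow> u = v" for u v by (simp add: \<psi>_def)
  have "x \<notin> C" using x(1) outside_no_overlap[of C] by (meson disjoint_iff)
  then have y_notin: "y \<notin> \<psi> ` C" using x(2) by (auto simp: inj)
  have y_ne: "y \<noteq> 0" using x w0 by (auto simp: \<psi>_def)
  have "continuous_on C \<psi>"
    unfolding \<psi>_def using w0 by (intro continuous_intros) auto
  then have comp: "compact (\<psi> ` C)"
    using \<open>compact C\<close> compact_continuous_image by blast
  define \<phi> where "\<phi> = (\<lambda>w. w\<^sub>0 + inverse w)"
  have \<phi>\<psi>: "\<phi> (\<psi> u) = u" for u by (simp add: \<phi>_def \<psi>_def)
  have \<psi>\<phi>: "\<psi> (\<phi> u) = u" for u by (simp add: \<phi>_def \<psi>_def)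
  define O' where "O' = outside (\<psi> ` C) - {0}"
  have "connected O'"
    unfolding O'_def using comp
    by (intro connected_open_delete open_outside connected_outside)
       (auto simp: compact_imp_closed compact_imp_bounded)
  moreover have "continuous_on O' \<phi>"
    unfolding \<phi>_def O'_def by (intro continuous_intros) auto
  ultimately have conn: "connected (\<phi> ` O')"
    using connected_continuous_image by blast
  have avoids: "\<phi> q \<notin> C" if "q \<in> O'" for q
  proof
    assume "\<phi> q \<in> C"
    then have "\<psi> (\<phi> q) \<in> \<psi> ` C" by (rule imageI)
    then show False
      using that outside_no_overlap[of "\<psi> ` C"] unfolding \<psi>\<phi> O'_def by blast
  qed
  have "open (inside C)"
    using \<open>compact C\<close> by (simp add: open_inside compact_imp_closed)
  then obtain e where e: "e > 0" "ball w\<^sub>0 e \<subseteq> inside C"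
    using \<open>w\<^sub>0 \<in> inside C\<close> open_contains_ball by blast
  have "\<not> bounded (outside (\<psi> ` C))"
    using comp by (simp add: unbounded_outside compact_imp_bounded)
  then obtain q where q: "q \<in> outside (\<psi> ` C)" "norm q > 1 / e"
    unfolding bounded_iff by (meson not_le)
  have "q \<noteq> 0" using q(2) e(1) by auto
  then have "q \<in> O'" using q(1) by (simp add: O'_def)
  have "norm (inverse q) < e"
    using q(2) e(1) \<open>q \<noteq> 0\<close> by (simp add: norm_inverse) (simp add: field_simps)
  then have "\<phi> q \<in> inside C"
    using e(2) by (auto simp: \<phi>_def dist_norm)
  \<comment> \<open>nonzero points outside the image curve come from the component of \<open>- C\<close> that contains \<open>w\<^sub>0\<close>\<close>
  have "y \<notin> outside (\<psi> ` C)"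
  proof
    assume "y \<in> outside (\<psi> ` C)"
    then have "\<phi> y \<in> \<phi> ` O'"
      using y_ne unfolding O'_def by (intro imageI) simp
    then have "x \<in> \<phi> ` O'" by (simp add: x(2) \<phi>\<psi>)
    moreover have "\<phi> ` O' \<subseteq> - C" using avoids by blast
    ultimately have "connected_component (- C) (\<phi> q) x"
      using conn \<open>q \<in> O'\<close> unfolding connected_component_def by blast
    then have "x \<in> inside C"
      using inside_same_component \<open>\<phi> q \<in> inside C\<close> by blast
    then show False using x(1) inside_Int_outside[of C] by blast
  qed
  then show "y \<in> inside (\<psi> ` C)"
    using y_notin by (simp add: inside_outside)
qed

text \<open>
  Inverting at a point inside the curve moves both chords from the outside to the inside.
\<close>

lemma no_crossing_chord_outside:
  fixes c :: "real \<Rightarrow> complex"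
  assumes c1: "simple_path c1" "pathstart c1 = a" "pathfinish c1 = b"
    and c2: "simple_path c2" "pathstart c2 = a" "pathfinish c2 = b"
    and c: "simple_path c" "pathstart c = a" "pathfinish c = b"
    and "a \<noteq> b"
    and meets: "path_image c1 \<inter> path_image c2 = {a, b}"
      "path_image c1 \<inter> path_image c = {a, b}"
      "path_image c2 \<inter> path_image c = {a, b}"
    and c_out: "path_image c - {a, b} \<subseteq> outside (path_image c1 \<union> path_image c2)"
    and D: "connected D" "D \<inter> path_image c = {}"
      "D \<subseteq> outside (path_image c1 \<union> path_image c2)"
    and u: "u \<in> closure D" "u \<in> path_image c1 - {a, b}"
    and v: "v \<in> closure D" "v \<in> path_image c2 - {a, b}"
  shows False
proof -
  let ?C = "path_image c1 \<union> path_image c2"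
  have "simple_path (c1 +++ reversepath c2)"
    using c1 c2 meets \<open>a \<noteq> b\<close>
    by (auto simp: simple_path_join_loop_eq arc_simple_path simple_path_reversepath)
  then have "inside (path_image (c1 +++ reversepath c2)) \<noteq> {}"
    using Jordan_inside_outside[of "c1 +++ reversepath c2"] c1 c2 by auto
  then have "inside ?C \<noteq> {}"
    using c1 c2 by (simp add: path_image_join)
  then obtain w\<^sub>0 where w0: "w\<^sub>0 \<in> inside ?C" by blast
  define \<psi> where "\<psi> = (\<lambda>w. inverse (w - w\<^sub>0))"
  have \<psi>_eq: "\<psi> x = \<psi> y \<longleftrightarrow> x = y" for x y by (simp add: \<psi>_def)
  have inj: "inj \<psi>" by (simp add: inj_def \<psi>_eq)
  have w0_notin: "w\<^sub>0 \<notin> ?C" "w\<^sub>0 \<notin> outside ?C"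
    using w0 inside_no_overlap[of ?C] inside_Int_outside[of ?C] by blast+
  have ab: "a \<in> ?C" "b \<in> ?C"
    using meets(1) by auto
  have w0_c: "w\<^sub>0 \<notin> path_image c"
    using w0_notin c_out ab by blast
  have cont: "continuous_on S \<psi>" if "w\<^sub>0 \<notin> S" for S
    unfolding \<psi>_def using that by (intro continuous_intros) auto
  have sp: "simple_path (\<psi> \<circ> g)" if "simple_path g" "w\<^sub>0 \<notin> path_image g" for g
    using that cont inj by (intro simple_path_continuous_image) (auto intro: inj_on_subset)
  have comp: "compact ?C"
    using c1(1) c2(1) by (simp add: compact_Un compact_simple_path_image)
  have "closure D \<subseteq> outside ?C \<union> ?C"
    using closure_mono[OF D(3)] closure_outside_subset[OF compact_imp_closed[OF comp]] by blast
  then have "continuous_on (closure D) \<psi>"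
    using w0_notin by (intro cont) blast
  then have "\<psi> ` closure D \<subseteq> closure (\<psi> ` D)"
    by (rule image_closure_subset) (auto simp: closure_subset)
  then have cl: "\<psi> x \<in> closure (\<psi> ` D)" if "x \<in> closure D" for x
    using that by blast
  have into: "\<psi> ` outside ?C \<subseteq> inside (\<psi> ` path_image c1 \<union> \<psi> ` path_image c2)"
    using inversion_maps_outside_to_inside[OF comp w0] by (simp add: \<psi>_def image_Un)
  show False
  proof (rule no_crossing_chord_inside[of "\<psi> \<circ> c1" "\<psi> a" "\<psi> b" "\<psi> \<circ> c2" "\<psi> \<circ> c" "\<psi> ` D" "\<psi> u" "\<psi> v"])
    show "simple_path (\<psi> \<circ> c1)" "simple_path (\<psi> \<circ> c2)" "simple_path (\<psi> \<circ> c)"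
      using sp c1(1) c2(1) c(1) w0_notin(1) w0_c by auto
    show "connected (\<psi> ` D)"
      using D(1,3) w0_notin(2) cont by (intro connected_continuous_image) auto
    show "path_image (\<psi> \<circ> c) - {\<psi> a, \<psi> b}
        \<subseteq> inside (path_image (\<psi> \<circ> c1) \<union> path_image (\<psi> \<circ> c2))"
      using into c_out by (fastforce simp: path_image_compose)
    show "\<psi> ` D \<subseteq> inside (path_image (\<psi> \<circ> c1) \<union> path_image (\<psi> \<circ> c2))"
      using into D(3) by (fastforce simp: path_image_compose)
    show "\<psi> ` D \<inter> path_image (\<psi> \<circ> c) = {}"
      using D(2) \<psi>_eq by (fastforce simp: path_image_compose)
    show "\<psi> u \<in> closure (\<psi> ` D)" "\<psi> v \<in> closure (\<psi> ` D)"
      using cl u v by auto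
    show "\<psi> u \<in> path_image (\<psi> \<circ> c1) - {\<psi> a, \<psi> b}" "\<psi> v \<in> path_image (\<psi> \<circ> c2) - {\<psi> a, \<psi> b}"
      using u(2) v(2) by (auto simp: path_image_compose \<psi>_eq)
    have "\<psi> ` path_image g \<inter> \<psi> ` path_image g' = {\<psi> a, \<psi> b}"
      if "path_image g \<inter> path_image g' = {a, b}" for g g'
      unfolding image_Int[OF inj, symmetric] that by simp
    note this[OF meets(1)] this[OF meets(2)] this[OF meets(3)]
    then show "path_image (\<psi> \<circ> c1) \<inter> path_image (\<psi> \<circ> c2) = {\<psi> a, \<psi> b}"
      "path_image (\<psi> \<circ> c1) \<inter> path_image (\<psi> \<circ> c) = {\<psi> a, \<psi> b}"
      "path_image (\<psi> \<circ> c2) \<inter> path_image (\<psi> \<circ> c) = {\<psi> a, \<psi> b}"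
      by (simp_all only: path_image_compose)
  qed (simp_all only: pathstart_compose pathfinish_compose c1 c2 c \<psi>_eq \<open>a \<noteq> b\<close> not_False_eq_True)
qed

text \<open>
  A plane drawing of the complete bipartite graph with parts \<open>I\<close> and \<open>J\<close>. All arcs run from \<open>I\<close> to \<open>J\<close>, so
  that two arcs with a common end are joined by reversing one of them.
\<close>

definition bipartite_arcs ::
    "'i set \<Rightarrow> 'j set \<Rightarrow> ('i \<Rightarrow> complex) \<Rightarrow> ('j \<Rightarrow> complex) \<Rightarrow>
      ('i \<Rightarrow> 'j \<Rightarrow> real \<Rightarrow> complex) \<Rightarrow> bool" where
  "bipartite_arcs I J a b h \<longleftrightarrow>
     (\<forall>i\<in>I. \<forall>j\<in>J. arc (h i j) \<and> pathstart (h i j) = a i \<and> pathfinish (h i j) = b j) \<and>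
     (\<forall>i\<in>I. \<forall>j\<in>J. \<forall>i'\<in>I. \<forall>j'\<in>J. (i, j) \<noteq> (i', j') \<longrightarrow>
        (\<forall>x \<in> path_image (h i j) \<inter> path_image (h i' j'). i = i' \<and> x = a i \<or> j = j' \<and> x = b j))"

lemma bipartite_arcsD:
  assumes "bipartite_arcs I J a b h" "i \<in> I" "j \<in> J"
  shows "arc (h i j)" "pathstart (h i j) = a i" "pathfinish (h i j) = b j"
    and "\<lbrakk>i' \<in> I; j' \<in> J; (i, j) \<noteq> (i', j'); x \<in> path_image (h i j); x \<in> path_image (h i' j')\<rbrakk>
      \<Longrightarrow> i = i' \<and> x = a i \<or> j = j' \<and> x = b j"
  using assms unfolding bipartite_arcs_def by (simp, simp, simp, blast)

text \<open>
  In the complete bipartite graph on 3 + 3 vertices, the six edges other than \<open>(i0, j1)\<close>, \<open>(i1, j2)\<close>,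
  \<open>(i2, j0)\<close> form a closed hexagon, and these three edges are its long diagonals.
\<close>

definition hexagon_rim :: "('i \<Rightarrow> 'j \<Rightarrow> real \<Rightarrow> complex) \<Rightarrow> 'i \<Rightarrow> 'i \<Rightarrow> 'i \<Rightarrow> 'j \<Rightarrow> 'j \<Rightarrow> 'j \<Rightarrow> complex set" where
  "hexagon_rim h i0 i1 i2 j0 j1 j2 =
     path_image (h i0 j0) \<union> path_image (h i1 j0) \<union> path_image (h i1 j1) \<union>
     path_image (h i2 j1) \<union> path_image (h i2 j2) \<union> path_image (h i0 j2)"

lemma arc_ends_in_closure_interior:
  fixes g :: "real \<Rightarrow> complex"
  assumes "arc g"
  shows "pathstart g \<in> closure (path_image g - {pathstart g, pathfinish g})"
    and "pathfinish g \<in> closure (path_image g - {pathstart g, pathfinish g})"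
proof -
  have "continuous_on (closure {0<..<1}) g"
    using arc_imp_path[OF assms] by (simp add: path_def)
  then have "g ` closure {0<..<1} \<subseteq> closure (g ` {0<..<1})"
    by (rule image_closure_subset) (auto simp: closure_subset)
  then have "path_image g \<subseteq> closure (path_image g - {pathstart g, pathfinish g})"
    using simple_path_endless[OF arc_imp_simple_path[OF assms]] by (simp add: path_image_def)
  then show "pathstart g \<in> closure (path_image g - {pathstart g, pathfinish g})"
    and "pathfinish g \<in> closure (path_image g - {pathstart g, pathfinish g})"
    using pathstart_in_path_image pathfinish_in_path_image by blast+
qed

text \<open>
  Along the rim, the ends \<open>a i1\<close> and \<open>b j2\<close> of the second diagonal lie in the two different arcs into which
  the ends \<open>a i0\<close> and \<open>b j1\<close> of the first one divide the hexagon, so the two diagonals are crossing chords.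
\<close>

lemma hexagon_chords_on_different_sides:
  assumes h: "bipartite_arcs I J a b h"
    and I: "distinct [i0, i1, i2]" "{i0, i1, i2} \<subseteq> I"
    and J: "distinct [j0, j1, j2]" "{j0, j1, j2} \<subseteq> J"
  defines "R \<equiv> hexagon_rim h i0 i1 i2 j0 j1 j2"
  shows "\<not> (path_image (h i0 j1) - {a i0, b j1} \<subseteq> inside R \<and>
            path_image (h i1 j2) - {a i1, b j2} \<subseteq> inside R)"
    and "\<not> (path_image (h i0 j1) - {a i0, b j1} \<subseteq> outside R \<and>
            path_image (h i1 j2) - {a i1, b j2} \<subseteq> outside R)"
proof -
  have sub: "i \<in> {i0, i1, i2} \<Longrightarrow> i \<in> I" "j \<in> {j0, j1, j2} \<Longrightarrow> j \<in> J" for i j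
    using I(2) J(2) by blast+
  have ends [simp]: "arc (h i j)" "pathstart (h i j) = a i" "pathfinish (h i j) = b j"
    if "i \<in> {i0, i1, i2}" "j \<in> {j0, j1, j2}" for i j
    using bipartite_arcsD[OF h sub(1)[OF that(1)] sub(2)[OF that(2)]] by simp_all
  have meet: "i = i' \<and> x = a i \<or> j = j' \<and> x = b j"
    if "x \<in> path_image (h i j)" "x \<in> path_image (h i' j')" "(i, j) \<noteq> (i', j')"
       "i \<in> {i0, i1, i2}" "j \<in> {j0, j1, j2}" "i' \<in> {i0, i1, i2}" "j' \<in> {j0, j1, j2}" for x i j i' j'
    by (rule bipartite_arcsD(4)[OF h]) (use sub that in blast)+
  have a_in: "a i \<in> path_image (h i j)" and b_in: "b j \<in> path_image (h i j)"
    if "i \<in> {i0, i1, i2}" "j \<in> {j0, j1, j2}" for i j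
    using pathstart_in_path_image[of "h i j"] pathfinish_in_path_image[of "h i j"] ends[OF that]
    by simp_all
  have same_a [simp]: "path_image (h i j) \<inter> path_image (h i j') = {a i}"
    if "i \<in> {i0, i1, i2}" "j \<in> {j0, j1, j2}" "j' \<in> {j0, j1, j2}" "j \<noteq> j'" for i j j'
    using meet[of _ i j i j'] a_in[of i] that by blast
  have same_b [simp]: "path_image (h i j) \<inter> path_image (h i' j) = {b j}"
    if "i \<in> {i0, i1, i2}" "i' \<in> {i0, i1, i2}" "j \<in> {j0, j1, j2}" "i \<noteq> i'" for i i' j
    using meet[of _ i j i' j] b_in[of _ j] that by blast
  have disj [simp]: "path_image (h i j) \<inter> path_image (h i' j') = {}"
    if "i \<in> {i0, i1, i2}" "i' \<in> {i0, i1, i2}" "j \<in> {j0, j1, j2}" "j' \<in> {j0, j1, j2}"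
       "i \<noteq> i'" "j \<noteq> j'" for i i' j j'
    using meet[of _ i j i' j'] that by blast
  have [simp]: "i0 \<noteq> i1" "i0 \<noteq> i2" "i1 \<noteq> i2" "i1 \<noteq> i0" "i2 \<noteq> i0" "i2 \<noteq> i1"
    "j0 \<noteq> j1" "j0 \<noteq> j2" "j1 \<noteq> j2" "j1 \<noteq> j0" "j2 \<noteq> j0" "j2 \<noteq> j1"
    using I(1) J(1) by auto
  define c1 where "c1 = h i0 j0 +++ reversepath (h i1 j0) +++ h i1 j1"
  define c2 where "c2 = h i0 j2 +++ reversepath (h i2 j2) +++ h i2 j1"
  define D where "D = path_image (h i1 j2) - {a i1, b j2}"
  have im1: "path_image c1 = path_image (h i0 j0) \<union> path_image (h i1 j0) \<union> path_image (h i1 j1)"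
    by (auto simp: c1_def path_image_join)
  have im2: "path_image c2 = path_image (h i0 j2) \<union> path_image (h i2 j2) \<union> path_image (h i2 j1)"
    by (auto simp: c2_def path_image_join)
  have R: "path_image c1 \<union> path_image c2 = R"
    unfolding im1 im2 R_def hexagon_rim_def by blast
  have arc1: "arc c1"
    unfolding c1_def
    by (intro arc_join arc_reversepath) (simp_all add: path_image_join Int_Un_distrib Int_Un_distrib2)
  have arc2: "arc c2"
    unfolding c2_def
    by (intro arc_join arc_reversepath) (simp_all add: path_image_join Int_Un_distrib Int_Un_distrib2)
  note sp1 = arc_imp_simple_path[OF arc1] and sp2 = arc_imp_simple_path[OF arc2]
  have sp: "simple_path (h i0 j1)" by (simp add: arc_imp_simple_path)
  have e1: "pathstart c1 = a i0" "pathfinish c1 = b j1" by (simp_all add: c1_def)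
  have e2: "pathstart c2 = a i0" "pathfinish c2 = b j1" by (simp_all add: c2_def)
  have e: "pathstart (h i0 j1) = a i0" "pathfinish (h i0 j1) = b j1" by simp_all
  have m12: "path_image c1 \<inter> path_image c2 = {a i0, b j1}"
    unfolding im1 im2 by (simp add: Int_Un_distrib Int_Un_distrib2 insert_commute)
  have m1: "path_image c1 \<inter> path_image (h i0 j1) = {a i0, b j1}"
    unfolding im1 by (simp add: Int_Un_distrib Int_Un_distrib2 insert_commute)
  have m2: "path_image c2 \<inter> path_image (h i0 j1) = {a i0, b j1}"
    unfolding im2 by (simp add: Int_Un_distrib Int_Un_distrib2 insert_commute)
  have D1: "connected D"
    using connected_simple_path_endless[of "h i1 j2"] by (simp add: D_def arc_imp_simple_path)
  have chords_disj: "path_image (h i0 j1) \<inter> path_image (h i1 j2) = {}" by simp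
  have D2: "D \<inter> path_image (h i0 j1) = {}"
    using chords_disj unfolding D_def by blast
  have u: "a i1 \<in> closure D" "b j2 \<in> closure D"
    using arc_ends_in_closure_interior[of "h i1 j2"] by (simp_all add: D_def)
  have "a i1 \<notin> path_image (h i0 j1)"
    using chords_disj a_in[of i1 j2] by blast
  moreover have "b j2 \<notin> path_image (h i0 j1)"
    using chords_disj b_in[of i1 j2] by blast
  ultimately have w: "a i1 \<in> path_image c1 - {a i0, b j1}" "b j2 \<in> path_image c2 - {a i0, b j1}"
    unfolding im1 im2 using a_in[of i0 j1] b_in[of i0 j1] a_in[of i1 j0] b_in[of i0 j2] by auto
  have ne: "a i0 \<noteq> b j1" using arc_distinct_ends[of "h i0 j1"] by simp
  note crossing = sp1 e1 sp2 e2 sp e ne m12 m1 m2 _ D1 D2 _ u(1) w(1) u(2) w(2)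
  show "\<not> (path_image (h i0 j1) - {a i0, b j1} \<subseteq> inside R \<and>
      path_image (h i1 j2) - {a i1, b j2} \<subseteq> inside R)"
    using no_crossing_chord_inside[OF crossing] unfolding R D_def by blast
  show "\<not> (path_image (h i0 j1) - {a i0, b j1} \<subseteq> outside R \<and>
      path_image (h i1 j2) - {a i1, b j2} \<subseteq> outside R)"
    using no_crossing_chord_outside[OF crossing] unfolding R D_def by blast
qed

text \<open>
  A diagonal without its end points is connected and avoids the rim.
\<close>

lemma hexagon_chord_inside_or_outside:
  assumes h: "bipartite_arcs I J a b h"
    and I: "distinct [i0, i1, i2]" "{i0, i1, i2} \<subseteq> I"
    and J: "distinct [j0, j1, j2]" "{j0, j1, j2} \<subseteq> J"
  defines "R \<equiv> hexagon_rim h i0 i1 i2 j0 j1 j2"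
  shows "path_image (h i0 j1) - {a i0, b j1} \<subseteq> inside R \<or>
         path_image (h i0 j1) - {a i0, b j1} \<subseteq> outside R"
proof -
  let ?D = "path_image (h i0 j1) - {a i0, b j1}"
  have arc: "arc (h i j)" if "i \<in> {i0, i1, i2}" "j \<in> {j0, j1, j2}" for i j
    using bipartite_arcsD(1)[OF h, of i j] I(2) J(2) that by blast
  have "compact R"
    unfolding R_def hexagon_rim_def by (intro compact_Un compact_arc_image arc) auto
  then have op: "open (inside R)" "open (outside R)"
    by (auto intro: open_inside open_outside compact_imp_closed)
  have "arc (h i0 j1)" "pathstart (h i0 j1) = a i0" "pathfinish (h i0 j1) = b j1"
    using bipartite_arcsD[OF h, of i0 j1] I(2) J(2) by simp_all
  then have conn: "connected ?D"
    using connected_simple_path_endless[of "h i0 j1"] by (simp add: arc_imp_simple_path)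
  have "?D \<inter> path_image (h i j) = {}" if "i \<in> {i0, i1, i2}" "j \<in> {j0, j1, j2}" "(i, j) \<noteq> (i0, j1)" for i j
    using bipartite_arcsD(4)[OF h, of i j i0 j1] I(2) J(2) that by blast
  then have "?D \<inter> R = {}"
    unfolding R_def hexagon_rim_def using I(1) J(1) by (simp add: Int_Un_distrib eq_commute)
  then have "?D \<subseteq> inside R \<union> outside R"
    by auto
  then show ?thesis
    using connectedD[OF conn op] inside_Int_outside[of R] by blast
qed

text \<open>
  Each of the three long diagonals of the hexagon lies inside or outside it, so two lie on the same
  side; rotating the hexagon makes any two diagonals the first and the second one.
\<close>

theorem no_bipartite_arcs_3_3:
  assumes "card I = 3" "card J = 3"
  shows "\<not> bipartite_arcs I J a b h"
proof
  assume h: "bipartite_arcs I J a b h"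
  obtain i0 i1 i2 where I: "I = {i0, i1, i2}" "distinct [i0, i1, i2]"
    using assms(1) by (auto simp: card_3_iff)
  obtain j0 j1 j2 where J: "J = {j0, j1, j2}" "distinct [j0, j1, j2]"
    using assms(2) by (auto simp: card_3_iff)
  define R where "R = hexagon_rim h i0 i1 i2 j0 j1 j2"
  have R1: "hexagon_rim h i1 i2 i0 j1 j2 j0 = R" and R2: "hexagon_rim h i2 i0 i1 j2 j0 j1 = R"
    unfolding R_def hexagon_rim_def by blast+
  note side = hexagon_chord_inside_or_outside[OF h]
  note differ = hexagon_chords_on_different_sides[OF h]
  have "distinct [i1, i2, i0]" "distinct [i2, i0, i1]" "distinct [j1, j2, j0]" "distinct [j2, j0, j1]"
    using I J by auto
  note d = I(2) J(2) this
  show False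
    using side[of i0 i1 i2 j0 j1 j2] side[of i1 i2 i0 j1 j2 j0] side[of i2 i0 i1 j2 j0 j1]
      differ[of i0 i1 i2 j0 j1 j2] differ[of i1 i2 i0 j1 j2 j0] differ[of i2 i0 i1 j2 j0 j1] d
    unfolding R1 R2 R_def[symmetric] I(1) J(1) by blast
qed

section \<open>Plane drawings of subdivided complete bipartite graphs\<close>

definition joined :: "('a, 'e) multigraph \<Rightarrow> 'a \<Rightarrow> 'a \<Rightarrow> bool" where
  "joined G u v \<longleftrightarrow> u \<noteq> v \<and> (\<exists>e\<in>edges G. ends G e = {u, v})"

lemma joined_sym: "joined G u v \<longleftrightarrow> joined G v u"
  by (auto simp: joined_def insert_commute)

text \<open>
  A walk is drawn inside the union of the edges induced by
  its vertex set. Such edge sets are disjoint for two walks that share at most one vertex, because loops are left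
  out and any other edge has two ends.
\<close>

definition induced_edges :: "('a, 'e) multigraph \<Rightarrow> 'a set \<Rightarrow> 'e set" where
  "induced_edges G A = {e \<in> edges G. \<exists>u v. u \<noteq> v \<and> ends G e = {u, v} \<and> u \<in> A \<and> v \<in> A}"

text \<open>
  The drawn edges of a walk are glued to a connected set, and a path-connected set contains an arc between
  any two of its points; thus no care is needed to concatenate and orient the drawn edges.
\<close>

lemma arc_along_walk:
  assumes draw: "plane_drawing G f g"
    and P: "set P \<subseteq> verts G" "successively (joined G) P" "P \<noteq> []" "hd P \<noteq> last P"
  obtains h where "arc h" "pathstart h = f (hd P)" "pathfinish h = f (last P)"
    "path_image h \<subseteq> (\<Union>e\<in>induced_edges G (set P). path_image (g e))"
proof -
  let ?W = "\<lambda>P. \<Union>e\<in>induced_edges G (set P). path_image (g e)"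
  have edge: "path_component (?W P) (f u) (f v)"
    if uv: "joined G u v" "u \<in> set P" "v \<in> set P" for u v P
  proof -
    obtain e where e: "e \<in> edges G" "ends G e = {u, v}" "u \<noteq> v"
      using uv(1) by (auto simp: joined_def)
    have "simple_path (g e)" and ends: "{pathstart (g e), pathfinish (g e)} = f ` ends G e"
      using draw e(1) by (auto simp: plane_drawing_def)
    then have "path_connected (path_image (g e))"
      by (simp add: path_connected_path_image simple_path_imp_path)
    moreover have "f u \<in> path_image (g e)" "f v \<in> path_image (g e)"
      using ends e(2) pathstart_in_path_image[of "g e"] pathfinish_in_path_image[of "g e"]
      by (auto simp: doubleton_eq_iff)
    ultimately have "path_component (path_image (g e)) (f u) (f v)"
      by (simp add: path_connected_component)
    moreover have "e \<in> induced_edges G (set P)"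
      using e uv by (auto simp: induced_edges_def)
    then have "path_image (g e) \<subseteq> ?W P" by blast
    ultimately show ?thesis by (metis path_component_of_subset)
  qed
  have "path_component (?W P) (f (hd P)) (f (last P))"
    if "successively (joined G) P" "length P \<ge> 2" for P
    using that
  proof (induction P rule: induct_list012)
    case (3 x y zs)
    have xy: "path_component (?W (x # y # zs)) (f x) (f y)"
      using 3 by (intro edge) auto
    show ?case
    proof (cases "zs = []")
      case True
      then show ?thesis using xy by simp
    next
      case False
      then have "path_component (?W (y # zs)) (f y) (f (last (y # zs)))"
        using 3 by (cases zs) auto
      moreover have "?W (y # zs) \<subseteq> ?W (x # y # zs)"
        unfolding induced_edges_def by fastforce
      ultimately have "path_component (?W (x # y # zs)) (f y) (f (last (y # zs)))"
        by (rule path_component_of_subset[rotated])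
      then show ?thesis
        using path_component_trans[OF xy] by simp
    qed
  qed auto
  moreover have "length P \<ge> 2"
    using P(3,4) by (cases P) (auto simp: Suc_le_eq split: if_splits)
  ultimately have "path_component (?W P) (f (hd P)) (f (last P))"
    using P(2) by blast
  then obtain \<gamma> where \<gamma>: "path \<gamma>" "path_image \<gamma> \<subseteq> ?W P" "pathstart \<gamma> = f (hd P)" "pathfinish \<gamma> = f (last P)"
    unfolding path_component_def by blast
  have "inj_on f (verts G)"
    using draw by (simp add: plane_drawing_def)
  then have "f (hd P) \<noteq> f (last P)"
    using P(1,4) hd_in_set[OF P(3)] last_in_set[OF P(3)] by (auto dest: inj_onD)
  then obtain h where "arc h" "path_image h \<subseteq> path_image \<gamma>"
      "pathstart h = f (hd P)" "pathfinish h = f (last P)"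
    using path_contains_arc[OF \<gamma>(1,3,4)] by metis
  then show thesis
    using that \<gamma>(2) by blast
qed

text \<open>
  Nine walks that pairwise share only their common branch vertices form a subdivision of the complete
  bipartite graph on 3 + 3 vertices. Drawing the walks as arcs contradicts \<open>no_bipartite_arcs_3_3\<close>: two walks
  share no edge, and distinct edges of a drawing meet only at images of common vertices.
\<close>

theorem K33_subdivision_not_planar:
  assumes I: "card I = 3" and J: "card J = 3"
    and P: "\<And>i j. i \<in> I \<Longrightarrow> j \<in> J \<Longrightarrow> P i j \<noteq> [] \<and> hd (P i j) = a i \<and> last (P i j) = b j \<and>
      set (P i j) \<subseteq> verts G \<and> successively (joined G) (P i j)"
    and meet: "\<And>i j i' j' v. \<lbrakk>i \<in> I; j \<in> J; i' \<in> I; j' \<in> J; (i, j) \<noteq> (i', j');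
      v \<in> set (P i j); v \<in> set (P i' j')\<rbrakk> \<Longrightarrow> i = i' \<and> v = a i \<or> j = j' \<and> v = b j"
  shows "\<not> planar G"
proof
  assume "planar G"
  then obtain f g where draw: "plane_drawing G f g" by (auto simp: planar_def)
  have ends_in: "a i \<in> set (P i j)" "b j \<in> set (P i j)" if "i \<in> I" "j \<in> J" for i j
    using P[OF that] hd_in_set[of "P i j"] last_in_set[of "P i j"] by auto
  have other: "\<exists>i'\<in>I. i' \<noteq> i" "\<exists>j'\<in>J. j' \<noteq> j" for i j
    using I J by (auto simp: card_3_iff)
  \<comment> \<open>if both ends agreed, this vertex would lie on two walks that have no end in common\<close>
  have ab: "a i \<noteq> b j" if ij: "i \<in> I" "j \<in> J" for i j
  proof
    assume eq: "a i = b j"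
    obtain i' j' where i'j': "i' \<in> I" "i' \<noteq> i" "j' \<in> J" "j' \<noteq> j"
      using other by blast
    show False
      using meet[of i j' i' j "a i"] ends_in(1)[OF ij(1) i'j'(3)] ends_in(2)[OF i'j'(1) ij(2)] ij i'j' eq
      by simp
  qed
  let ?W = "\<lambda>i j. \<Union>e\<in>induced_edges G (set (P i j)). path_image (g e)"
  let ?drawn = "\<lambda>i j h. arc h \<and> pathstart h = f (a i) \<and> pathfinish h = f (b j) \<and> path_image h \<subseteq> ?W i j"
  define h where "h = (\<lambda>i j. SOME h. ?drawn i j h)"
  have "?drawn i j (h i j)" if ij: "i \<in> I" "j \<in> J" for i j
  proof -
    obtain h' where "?drawn i j h'"
      using arc_along_walk[OF draw, of "P i j"] P[OF ij] ab[OF ij] by metis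
    then show ?thesis unfolding h_def by (rule someI[of "?drawn i j"])
  qed
  then have h: "arc (h i j)" "pathstart (h i j) = f (a i)" "pathfinish (h i j) = f (b j)"
    "path_image (h i j) \<subseteq> ?W i j" if "i \<in> I" "j \<in> J" for i j
    using that by blast+
  have "i = i' \<and> x = f (a i) \<or> j = j' \<and> x = f (b j)"
    if ij: "i \<in> I" "j \<in> J" "i' \<in> I" "j' \<in> J" "(i, j) \<noteq> (i', j')"
      and x: "x \<in> path_image (h i j)" "x \<in> path_image (h i' j')" for i j i' j' x
  proof -
    obtain e where e: "e \<in> induced_edges G (set (P i j))" "x \<in> path_image (g e)"
      using x(1) h(4) ij by blast
    obtain e' where e': "e' \<in> induced_edges G (set (P i' j'))" "x \<in> path_image (g e')"
      using x(2) h(4) ij by blast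
    have sub: "ends G e \<subseteq> set (P i j)" "ends G e' \<subseteq> set (P i' j')"
      using e(1) e'(1) by (auto simp: induced_edges_def)
    have "e \<noteq> e'"
    proof
      assume "e = e'"
      obtain u v where uv: "u \<noteq> v" "ends G e = {u, v}"
        using e(1) by (auto simp: induced_edges_def)
      then show False
        using meet[OF ij, of u] meet[OF ij, of v] sub \<open>e = e'\<close> ij(5) by auto
    qed
    moreover have "e \<in> edges G" "e' \<in> edges G"
      using e e' by (auto simp: induced_edges_def)
    ultimately have "x \<in> f ` (ends G e \<inter> ends G e')"
      using draw e(2) e'(2) unfolding plane_drawing_def by blast
    then obtain v where "x = f v" "v \<in> set (P i j)" "v \<in> set (P i' j')"
      using sub by blast
    then show ?thesis using meet[OF ij] by blast
  qed
  then have "bipartite_arcs I J (f \<circ> a) (f \<circ> b) h"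
    unfolding bipartite_arcs_def using h by (simp add: Ball_def)
  then show False
    using no_bipartite_arcs_3_3[OF I J] by blast
qed

text \<open>
  It suffices to check the intersection pattern on labels of the vertices. This separates the
  combinatorics of the walks from the arithmetic, which enters only through the labelling \<open>\<phi>\<close>.
\<close>

corollary K33_subdivision_image_not_planar:
  assumes I: "card I = 3" and J: "card J = 3"
    and \<phi>: "inj_on \<phi> L" "\<phi> ` L \<subseteq> verts G"
    and P: "\<And>i j. i \<in> I \<Longrightarrow> j \<in> J \<Longrightarrow> P i j \<noteq> [] \<and> hd (P i j) = a i \<and> last (P i j) = b j \<and>
      set (P i j) \<subseteq> L \<and> successively (\<lambda>x y. joined G (\<phi> x) (\<phi> y)) (P i j)"
    and meet: "\<And>i j i' j' v. \<lbrakk>i \<in> I; j \<in> J; i' \<in> I; j' \<in> J; (i, j) \<noteq> (i', j');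
      v \<in> set (P i j); v \<in> set (P i' j')\<rbrakk> \<Longrightarrow> i = i' \<and> v = a i \<or> j = j' \<and> v = b j"
  shows "\<not> planar G"
proof (rule K33_subdivision_not_planar[OF I J])
  fix i j assume ij: "i \<in> I" "j \<in> J"
  show "map \<phi> (P i j) \<noteq> [] \<and> hd (map \<phi> (P i j)) = (\<phi> \<circ> a) i \<and> last (map \<phi> (P i j)) = (\<phi> \<circ> b) j \<and>
      set (map \<phi> (P i j)) \<subseteq> verts G \<and> successively (joined G) (map \<phi> (P i j))"
    using P[OF ij] \<phi>(2) by (auto simp: hd_map last_map successively_map)
next
  fix i j i' j' v
  assume ij: "i \<in> I" "j \<in> J" "i' \<in> I" "j' \<in> J" "(i, j) \<noteq> (i', j')"
    and v: "v \<in> set (map \<phi> (P i j))" "v \<in> set (map \<phi> (P i' j'))"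
  obtain x y where x: "x \<in> set (P i j)" "v = \<phi> x" and y: "y \<in> set (P i' j')" "v = \<phi> y"
    using v by auto
  have "x = y"
    using inj_onD[OF \<phi>(1), of x y] x y P ij by blast
  then show "i = i' \<and> v = (\<phi> \<circ> a) i \<or> j = j' \<and> v = (\<phi> \<circ> b) j"
    using meet[OF ij, of x] x y by auto
qed

section \<open>Moves and vertices of the Markoff graph modulo p\<close>

definition residue_triple :: "nat \<Rightarrow> int \<times> int \<times> int \<Rightarrow> int \<times> int \<times> int" where
  "residue_triple p = (\<lambda>(x, y, z). (x mod int p, y mod int p, z mod int p))"

lemma residue_triple_eq_iff:
  "residue_triple p (x, y, z) = residue_triple p (x', y', z') \<longleftrightarrow>
     [x = x'] (mod int p) \<and> [y = y'] (mod int p) \<and> [z = z'] (mod int p)"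
  by (simp add: residue_triple_def Cong.cong_def)

context
  fixes p :: nat
  assumes p: "1 < p"
begin

interpretation R: residues "int p" "residue_ring (int p)"
  by unfold_locales (use p in simp_all)

lemma residue_triple_in_markoff_triples:
  assumes "[x^2 + y^2 + z^2 = x * y * z] (mod int p)"
    and "\<not> (int p dvd x \<and> int p dvd y \<and> int p dvd z)"
  shows "residue_triple p (x, y, z) \<in> markoff_triples (residue_ring (int p))"
  using assms
  by (simp add: residue_triple_def markoff_triples_def R.res_to_cong_simps R.zero_cong dvd_eq_mod_eq_0)

lemma markoff_moves_residue_triple:
  "markoff_m1 (residue_ring (int p)) (residue_triple p (x, y, z)) = residue_triple p (y * z - x, y, z)"
  "markoff_m2 (residue_ring (int p)) (residue_triple p (x, y, z)) = residue_triple p (x, x * z - y, z)"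
  "markoff_m3 (residue_ring (int p)) (residue_triple p (x, y, z)) = residue_triple p (x, y, x * y - z)"
  by (simp_all add: residue_triple_def a_minus_def R.mult_cong R.neg_cong R.add_cong)

lemma joined_markoff_move:
  assumes v: "residue_triple p (x, y, z) \<in> markoff_triples (residue_ring (int p))"
    and w: "w \<in> {residue_triple p (y * z - x, y, z), residue_triple p (x, x * z - y, z), residue_triple p (x, y, x * y - z)}"
    and "residue_triple p (x, y, z) \<noteq> w"
  shows "joined (markoff_graph (residue_ring (int p))) (residue_triple p (x, y, z)) w"
  unfolding joined_def
proof
  let ?v = "residue_triple p (x, y, z)"
  have "(1, {?v, residue_triple p (y * z - x, y, z)}) \<in> edges (markoff_graph (residue_ring (int p)))"
    "(2, {?v, residue_triple p (x, x * z - y, z)}) \<in> edges (markoff_graph (residue_ring (int p)))"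
    "(3, {?v, residue_triple p (x, y, x * y - z)}) \<in> edges (markoff_graph (residue_ring (int p)))"
    unfolding markoff_graph_def markoff_moves_residue_triple[symmetric] using v by (simp_all) blast+
  then obtain j where "(j, {?v, w}) \<in> edges (markoff_graph (residue_ring (int p)))"
    using w by blast
  moreover have "ends (markoff_graph (residue_ring (int p))) = snd"
    by (simp add: markoff_graph_def)
  ultimately show "\<exists>e\<in>edges (markoff_graph (residue_ring (int p))).
      ends (markoff_graph (residue_ring (int p))) e = {?v, w}"
    by force
qed fact

end

text \<open>
  The excluded residues modulo 28 are those that are 3 modulo 4 and a non-square modulo 7. Every other
  prime \<open>p \<noteq> 7\<close> with \<open>p mod 4 = 3\<close> is a square modulo 7, so by quadratic reciprocity 7 is a non-square
  modulo \<open>p\<close>, as is -1; hence their product is a square.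
\<close>

lemma sqrt_minus_7_mod:
  assumes "prime p" "odd p" "p \<noteq> 7" "p mod 28 \<notin> {3, 19, 27}" "p mod 4 = 3"
  shows "QuadRes (int p) (-7)"
proof -
  have p: "2 < p" using assms(1,2) by (metis le_neq_implies_less even_numeral prime_ge_2_nat)
  have "p mod 28 \<in> {7, 11, 15, 23}"
  proof -
    have "p mod 28 < 28" "(p mod 28) mod 4 = 3" using assms(5) by (simp_all add: mod_mod_cancel)
    then have s: "p mod 28 = 4 * (p mod 28 div 4) + 3" "p mod 28 div 4 < 7"
      using mult_div_mod_eq[of 4 "p mod 28"] by linarith+
    define s where "s = p mod 28 div 4"
    note s = s[folded s_def]
    have "s = 0 \<or> s = 1 \<or> s = 2 \<or> s = 3 \<or> s = 4 \<or> s = 5 \<or> s = 6" using s(2) by arith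
    then show ?thesis using assms(4) s(1) by auto
  qed
  moreover have "p mod 28 \<noteq> 7"
  proof
    assume "p mod 28 = 7"
    then have "7 dvd p" using mod_mod_cancel[of 7 28 p] by (simp add: dvd_eq_mod_eq_0)
    then show False using assms(1,3) primes_dvd_imp_eq[of 7 p] by simp
  qed
  ultimately have "p mod 7 = 4 \<or> p mod 7 = 1 \<or> p mod 7 = 2"
    using mod_mod_cancel[of 7 28 p] by auto
  then have "[2^2 = int p] (mod 7) \<or> [1^2 = int p] (mod 7) \<or> [3^2 = int p] (mod 7)"
    unfolding Cong.cong_def by (auto; presburger)
  then have "QuadRes 7 (int p)" unfolding QuadRes_def by blast
  moreover have "\<not> [int p = 0] (mod 7)"
    using \<open>p mod 7 = 4 \<or> _\<close> unfolding Cong.cong_def by (auto; presburger)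
  ultimately have p7: "Legendre (int p) 7 = 1" by (simp add: Legendre_def)
  have odd: "odd ((p - 1) div 2)" using assms(5) by presburger
  have "Legendre (int p) (int 7) * Legendre (int 7) (int p) = (-1) ^ ((p - 1) div 2 * ((7 - 1) div 2))"
    using assms(1,3) p by (intro Quadratic_Reciprocity) simp_all
  then have "Legendre 7 (int p) = -1" using p7 odd by (simp add: power_mult)
  have "[Legendre (-7) (int p) = (-7) ^ ((p - 1) div 2)] (mod int p)"
    "[Legendre 7 (int p) = 7 ^ ((p - 1) div 2)] (mod int p)"
    using euler_criterion[of p] assms(1) p by auto
  then have "[Legendre (-7) (int p) = 1] (mod int p)"
    using odd \<open>Legendre 7 (int p) = -1\<close>
    by (metis cong_minus_minus_iff cong_sym cong_trans minus_minus power_minus_odd)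
  moreover have "\<not> [-1 = 1] (mod int p)" "\<not> [0 = 1] (mod int p)"
    using p zdvd_imp_le[of "int p" 2] by (auto simp: cong_iff_dvd_diff)
  ultimately show ?thesis by (auto simp: Legendre_def split: if_splits)
qed

lemma sqrt_minus_1_mod:
  assumes "prime p" "p mod 4 = 1"
  shows "QuadRes (int p) (-1)"
proof -
  have p: "2 < p"
    using prime_ge_2_nat[OF assms(1)] assms(2) by (cases "p = 2") auto
  have even: "even ((p - 1) div 2)" using assms(2) by presburger
  have "[Legendre (-1) (int p) = (-1) ^ ((p - 1) div 2)] (mod int p)"
    using euler_criterion[of p] assms(1) p by auto
  then have "[Legendre (-1) (int p) = 1] (mod int p)"
    using even by simp
  moreover have "\<not> [-1 = 1] (mod int p)" "\<not> [0 = 1] (mod int p)"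
    using p zdvd_imp_le[of "int p" 2] by (auto simp: cong_iff_dvd_diff)
  ultimately show ?thesis by (auto simp: Legendre_def split: if_splits)
qed

section \<open>The case of a square root of -1\<close>

text \<open>
  For \<open>t\<^sup>2 = -4\<close>, the Markoff triples with first coordinate 2 are \<open>(2, y, y \<plusminus> t)\<close>, since the equation becomes
  \<open>(y - z)\<^sup>2 = -4\<close>. The second and third move alternately replace the first of two consecutive
  multiples \<open>t k\<close>, \<open>t (k + 1)\<close> by \<open>t (k + 2)\<close>, so position \<open>k\<close> holds \<open>t k\<close>, \<open>t (k + 1)\<close> in an order given by the
  parity of \<open>k\<close>. Modulo an odd prime \<open>p\<close> the order is reversed after \<open>p\<close> steps, and the triples
  form one cycle of length \<open>2 p\<close>. The sign \<open>s = -1\<close> gives the cycle for the first coordinate -2.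
\<close>

definition long_cycle_vertex :: "int \<Rightarrow> int \<times> nat \<Rightarrow> int \<times> int \<times> int" where
  "long_cycle_vertex t = (\<lambda>(s, k).
     if even k then (2 * s, t * int k, s * (t * (int k + 1)))
     else (2 * s, t * (int k + 1), s * (t * int k)))"

text \<open>
  The first move joins the two cycles with first coordinates 2 and -2 where \<open>y z = 0\<close>, that is at the
  positions \<open>0\<close>, \<open>p - 1\<close>, \<open>p\<close>, \<open>2 p - 1\<close>. It preserves the positions \<open>p - 1\<close> and \<open>p\<close> but exchanges \<open>0\<close>
  and \<open>2 p - 1\<close>, so the four rungs attach to the two cycles in incompatible cyclic orders. Write A, C, D, B for
  the vertices at positions \<open>0\<close>, \<open>p - 1\<close>, \<open>p\<close>, \<open>2 p - 1\<close> of the first cycle. Removing the edge that closes the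
  second cycle leaves a subdivision of the complete bipartite graph: one part consists of A, D and the
  partner of C, the other of B, C and the partner of D.
\<close>

lemma markoff_not_planar_if_sqrt_minus_1:
  assumes "prime p" "odd p" "QuadRes (int p) (-1)"
  shows "\<not> planar (markoff_graph (residue_ring (int p)))"
proof -
  let ?G = "markoff_graph (residue_ring (int p))"
  have p1: "1 < p" using prime_gt_1_nat[OF assms(1)] .
  have pp: "prime (int p)" using assms(1) by simp
  have p3: "p \<ge> 3" using p1 assms(2) by (cases "p = 2") auto
  have not_dvd2: "\<not> int p dvd 2"
    using p3 zdvd_imp_le[of "int p" 2] by auto
  obtain r where r: "[r^2 = -1] (mod int p)"
    using assms(3) by (auto simp: QuadRes_def)
  define t where "t = 2 * r"
  have "[2^2 * r^2 = 2^2 * (-1)] (mod int p)"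
    using r by (rule cong_scalar_left)
  then have tt: "int p dvd t^2 + 4"
    by (simp add: t_def power_mult_distrib cong_iff_dvd_diff)
  have t: "\<not> int p dvd t"
  proof
    assume "int p dvd t"
    then have "int p dvd t^2" by (simp add: power2_eq_square)
    then have "int p dvd 2 * 2" using tt dvd_add_right_iff[of "int p" "t^2" 4] by simp
    then show False using not_dvd2 prime_dvd_mult_iff[OF pp] by blast
  qed
  have t_cancel: "[t * x = t * y] (mod int p) \<longleftrightarrow> int p dvd x - y" for x y
    unfolding cong_iff_dvd_diff right_diff_distrib[symmetric]
    using t prime_dvd_mult_iff[OF pp] by blast
  define \<phi> where "\<phi> = (\<lambda>v. residue_triple p (long_cycle_vertex t v))"
  have \<phi>_even: "\<phi> (s, k) = residue_triple p (2 * s, t * int k, s * (t * (int k + 1)))" if "even k" for s k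
    using that by (simp add: \<phi>_def long_cycle_vertex_def)
  have \<phi>_odd: "\<phi> (s, k) = residue_triple p (2 * s, t * (int k + 1), s * (t * int k))" if "odd k" for s k
    using that by (simp add: \<phi>_def long_cycle_vertex_def)
  define L where "L = {1, -1 :: int} \<times> {..<2 * p}"
  have unit_cancel: "[s * x = s * y] (mod int p) \<longleftrightarrow> [x = y] (mod int p)" if "s \<in> {1, -1}" for s x y
    using that by (auto simp: cong_minus_minus_iff)
  have inj: "inj_on \<phi> L"
  proof (rule inj_onI, clarify)
    fix s k s' k'
    assume L: "(s, k) \<in> L" "(s', k') \<in> L" and eq: "\<phi> (s, k) = \<phi> (s', k')"
    have k: "k < 2 * p" "k' < 2 * p" and s: "s \<in> {1, -1}" "s' \<in> {1, -1}"
      using L by (auto simp: L_def)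
    have "[2 * s = 2 * s'] (mod int p)"
      using eq by (auto simp: \<phi>_def long_cycle_vertex_def residue_triple_eq_iff split: if_splits)
    then have "int p dvd 2 * (s - s')"
      by (simp add: cong_iff_dvd_diff right_diff_distrib)
    then have "int p dvd s - s'"
      using not_dvd2 prime_dvd_mult_iff[OF pp] by blast
    then have ss: "s = s'"
      using s not_dvd2 by auto
    show "s = s' \<and> k = k'"
    proof (cases "even k \<longleftrightarrow> even k'")
      case True
      then have "int p dvd int k - int k'"
        using eq s(1) unfolding ss
        by (cases "even k") (auto simp: \<phi>_even \<phi>_odd residue_triple_eq_iff t_cancel unit_cancel)
      moreover have "2 dvd int k - int k'" using True by simp
      moreover have "coprime (int p) 2" using assms(2) by simp
      ultimately have "int p * 2 dvd int k - int k'" by (intro divides_mult) auto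
      moreover have "\<bar>int k - int k'\<bar> < int p * 2" using k by linarith
      ultimately have "k = k'"
        using dvd_imp_le_int[of "int k - int k'" "int p * 2"] by fastforce
      then show ?thesis using ss by simp
    next
      case False
      have "int p dvd int k - (int k' + 1) \<and> int p dvd (int k + 1) - int k'"
        using False eq s(2) unfolding ss
        by (cases "even k") (auto simp: \<phi>_even \<phi>_odd residue_triple_eq_iff t_cancel unit_cancel)
      then have "int p dvd ((int k + 1) - int k') - (int k - (int k' + 1))"
        using dvd_diff by blast
      then show ?thesis using not_dvd2 by simp
    qed
  qed
  have mark: "\<phi> (s, k) \<in> markoff_triples (residue_ring (int p))" if s: "s \<in> {1, -1}" for s k
  proof -
    obtain y z where v: "\<phi> (s, k) = residue_triple p (2 * s, y, s * z)" and yz: "(y - z)^2 = t^2"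
    proof (cases "even k")
      case True
      then show ?thesis
        by (intro that[OF \<phi>_even]) (simp_all add: power2_eq_square algebra_simps)
    next
      case False
      then show ?thesis
        by (intro that[OF \<phi>_odd]) (simp_all add: power2_eq_square algebra_simps)
    qed
    have "(2 * s)^2 + y^2 + (s * z)^2 - 2 * s * y * (s * z) = (y - z)^2 + 4"
      using s by (auto simp: power2_eq_square algebra_simps)
    then have "[(2 * s)^2 + y^2 + (s * z)^2 = 2 * s * y * (s * z)] (mod int p)"
      using tt yz by (simp add: cong_iff_dvd_diff)
    moreover have "\<not> int p dvd 2 * s" using not_dvd2 s by auto
    ultimately show ?thesis
      unfolding v by (intro residue_triple_in_markoff_triples p1) auto
  qed
  then have verts: "\<phi> ` L \<subseteq> verts ?G"
    by (auto simp: L_def markoff_graph_def)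
  \<comment> \<open>position \<open>2 p\<close> is again position 0, so the closing edge of the cycle is an ordinary step\<close>
  have period: "\<phi> (s, 2 * p) = \<phi> (s, 0)" for s
    by (simp add: \<phi>_even residue_triple_eq_iff cong_iff_dvd_diff algebra_simps)
  have move: "joined ?G (\<phi> (s, k)) w"
    if s: "s \<in> {1, -1}" and v: "\<phi> (s, k) = residue_triple p (x, y, z)" "\<phi> (s, k) \<noteq> w"
      and "w = residue_triple p (y * z - x, y, z) \<or> w = residue_triple p (x, x * z - y, z) \<or> w = residue_triple p (x, y, x * y - z)"
    for s k x y z w
    using mark[OF s, of k] that unfolding v(1) by (intro joined_markoff_move p1) auto
  have neq: "\<phi> u \<noteq> \<phi> v" if "u \<in> L" "v \<in> L" "u \<noteq> v" for u v
    using inj that by (auto dest: inj_onD)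
  have step: "\<phi> (s, Suc k) = (let (x, y, z) = long_cycle_vertex t (s, k) in
      if even k then residue_triple p (x, x * z - y, z) else residue_triple p (x, y, x * y - z))" if "s \<in> {1, -1}" for s k
    using that by (auto simp: \<phi>_def long_cycle_vertex_def algebra_simps)
  have joined_step: "joined ?G (\<phi> (s, k)) (\<phi> (s, Suc k))"
    if s: "s \<in> {1, -1}" and ne: "\<phi> (s, k) \<noteq> \<phi> (s, Suc k)" for s k
  proof (cases "even k")
    case True
    show ?thesis
      by (rule move[OF s \<phi>_even[OF True] ne]) (use s True in \<open>auto simp: step long_cycle_vertex_def\<close>)
  next
    case False
    show ?thesis
      by (rule move[OF s \<phi>_odd[OF False] ne]) (use s False in \<open>auto simp: step long_cycle_vertex_def\<close>)
  qed
  have cycle: "joined ?G (\<phi> (s, k)) (\<phi> (s, Suc k))" if s: "s \<in> {1, -1}" and k: "Suc k < 2 * p" for s k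
    using s k by (intro joined_step neq) (auto simp: L_def)
  have close: "joined ?G (\<phi> (1, 2 * p - 1)) (\<phi> (1, 0))"
    using joined_step[of 1 "2 * p - 1"] neq[of "(1, 2 * p - 1)" "(1, 0)"] p3
    by (auto simp: L_def period)
  have flip: "joined ?G (\<phi> (1, k)) (\<phi> (-1, l))"
    if k: "\<phi> (1, k) = residue_triple p (2, y, z)" and l: "\<phi> (-1, l) = residue_triple p (-2, y, z)"
      and kl: "k < 2 * p" "l < 2 * p" and yz: "int p dvd y * z" for k l y z
  proof (rule move[OF _ k])
    show "\<phi> (1, k) \<noteq> \<phi> (-1, l)" using kl by (intro neq) (auto simp: L_def)
    have "residue_triple p (-2, y, z) = residue_triple p (y * z - 2, y, z)"
      using yz by (simp add: residue_triple_eq_iff cong_iff_dvd_diff)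
    then show "\<phi> (-1, l) = residue_triple p (y * z - 2, y, z) \<or> \<phi> (-1, l) = residue_triple p (2, 2 * z - y, z) \<or>
        \<phi> (-1, l) = residue_triple p (2, y, 2 * y - z)"
      using l by simp
  qed simp
  have evens: "even (p - 1)" "odd (2 * p - 1)" using assms(2) p3 by auto
  have ints: "int (p - 1) = int p - 1" "int (2 * p - 1) = 2 * int p - 1" using p3 by auto
  note flip_simps = \<phi>_even \<phi>_odd evens assms(2) ints residue_triple_eq_iff cong_iff_dvd_diff algebra_simps
  have flips: "joined ?G (\<phi> (1, 0)) (\<phi> (-1, 2 * p - 1))" "joined ?G (\<phi> (1, 2 * p - 1)) (\<phi> (-1, 0))"
    "joined ?G (\<phi> (1, p - 1)) (\<phi> (-1, p - 1))" "joined ?G (\<phi> (1, p)) (\<phi> (-1, p))"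
    by (rule flip[of _ 0 t] flip[of _ 0 "- t"] flip[of _ "- t" 0] flip[of _ t 0];
        use p3 in \<open>simp add: flip_simps\<close>)+
  have arc: "successively (\<lambda>u v. joined ?G (\<phi> u) (\<phi> v)) (map (Pair s) [k..<l])"
    if "s \<in> {1, -1}" "l \<le> 2 * p" for s k l
    unfolding successively_conv_nth using that by (auto intro!: cycle)
  have rev_arc: "successively (\<lambda>u v. joined ?G (\<phi> u) (\<phi> v)) (rev (map (Pair s) [k..<l]))"
    if "s \<in> {1, -1}" "l \<le> 2 * p" for s k l
    using arc[OF that] unfolding successively_rev by (simp add: joined_sym[of ?G])
  \<comment> \<open>the long walks run along half of a cycle; \<open>P 0 2\<close> and \<open>P 2 0\<close> also cross a rung at position \<open>0\<close> or \<open>2 p - 1\<close>\<close>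
  define P :: "nat \<Rightarrow> nat \<Rightarrow> (int \<times> nat) list" where
    "P = (\<lambda>i j.
      [[[(1, 0), (1, 2 * p - 1)], map (Pair 1) [0..<p], (1, 0) # rev (map (Pair (-1)) [p..<2 * p])],
       [map (Pair 1) [p..<2 * p], [(1, p), (1, p - 1)], [(1, p), (-1, p)]],
       [rev (map (Pair (-1)) [0..<p]) @ [(1, 2 * p - 1)], [(-1, p - 1), (1, p - 1)], [(-1, p - 1), (-1, p)]]] ! i ! j)"
  define a b where "a = (!) [(1::int, 0), (1, p), (-1, p - 1)]"
    and "b = (!) [(1::int, 2 * p - 1), (1, p - 1), (-1, p)]"
  note defs = P_def a_def b_def
  have "Suc (p - 1) = p" using p3 by simp
  then have mid: "joined ?G (\<phi> (s, p - 1)) (\<phi> (s, p))" if "s \<in> {1, -1}" for s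
    using cycle[OF that, of "p - 1"] p3 by simp
  note joins = flips mid[of 1] mid[of "-1"] close
  note joins = joins joins[THEN joined_sym[THEN iffD1]]
  show ?thesis
  proof (rule K33_subdivision_image_not_planar[of "{0, 1, 2}" "{0, 1, 2}" \<phi> L _ P a b])
    show "P i j \<noteq> [] \<and> hd (P i j) = a i \<and> last (P i j) = b j \<and> set (P i j) \<subseteq> L \<and>
      successively (\<lambda>x y. joined ?G (\<phi> x) (\<phi> y)) (P i j)" if "i \<in> {0, 1, 2}" "j \<in> {0, 1, 2}" for i j
      using that joins arc rev_arc p3 unfolding defs 
      by (auto simp: L_def successively_Cons successively_append_iff hd_map last_map hd_rev last_rev hd_append)
  next
    fix i j i' j' v
    assume ij: "i \<in> {0, 1, 2}" "j \<in> {0, 1, 2}" "i' \<in> {0, 1, 2}" "j' \<in> {0, 1, 2}" "(i, j) \<noteq> (i', j')"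
      and v_in: "v \<in> set (P i j)" "v \<in> set (P i' j')"
    obtain s k where v: "v = (s, k)" by (cases v)
    obtain q where q: "p = Suc q" "q \<ge> 2" using p3 by (cases p) auto
    have mem: "v \<in> set (P 0 0) \<longleftrightarrow> s = 1 \<and> (k = 0 \<or> k = Suc (2 * q))"
      "v \<in> set (P 0 1) \<longleftrightarrow> s = 1 \<and> k < Suc q"
      "v \<in> set (P 0 2) \<longleftrightarrow> s = 1 \<and> k = 0 \<or> s = -1 \<and> Suc q \<le> k \<and> k < Suc (Suc (2 * q))"
      "v \<in> set (P 1 0) \<longleftrightarrow> s = 1 \<and> Suc q \<le> k \<and> k < Suc (Suc (2 * q))"
      "v \<in> set (P 1 1) \<longleftrightarrow> s = 1 \<and> (k = Suc q \<or> k = q)"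
      "v \<in> set (P 1 2) \<longleftrightarrow> (s = 1 \<or> s = -1) \<and> k = Suc q"
      "v \<in> set (P 2 0) \<longleftrightarrow> s = -1 \<and> k < Suc q \<or> s = 1 \<and> k = Suc (2 * q)"
      "v \<in> set (P 2 1) \<longleftrightarrow> (s = 1 \<or> s = -1) \<and> k = q"
      "v \<in> set (P 2 2) \<longleftrightarrow> s = -1 \<and> (k = q \<or> k = Suc q)"
      unfolding P_def v q by auto
    have ab: "v = a 0 \<longleftrightarrow> s = 1 \<and> k = 0" "v = a 1 \<longleftrightarrow> s = 1 \<and> k = Suc q" "v = a 2 \<longleftrightarrow> s = -1 \<and> k = q"
      "v = b 0 \<longleftrightarrow> s = 1 \<and> k = Suc (2 * q)" "v = b 1 \<longleftrightarrow> s = 1 \<and> k = q" "v = b 2 \<longleftrightarrow> s = -1 \<and> k = Suc q"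
      by (simp_all add: a_def b_def v q)
    have "i = 0 \<or> i = 1 \<or> i = 2" "j = 0 \<or> j = 1 \<or> j = 2" "i' = 0 \<or> i' = 1 \<or> i' = 2" "j' = 0 \<or> j' = 1 \<or> j' = 2"
      using ij by simp_all
    then show "i = i' \<and> v = a i \<or> j = j' \<and> v = b j"
      using q(2) ij(5) v_in
      by (elim disjE; simp add: mem ab del: One_nat_def; linarith?)
  qed (use inj verts in simp_all)
qed

section \<open>The case of a square root of -7\<close>

text \<open>
  Let \<open>z\<close>, \<open>z'\<close> be the roots of \<open>X\<^sup>2 - X + 2\<close>, whose discriminant is -7. The three triples arranged from
  \<open>-1, -1, z\<close>, the three from \<open>-1, -1, z'\<close> and the six from \<open>-1, z, z'\<close> are Markoff triples. The moves that keep a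
  coordinate -1 fixed arrange these twelve vertices in a cycle and add three edges that
  replace \<open>z\<close> by \<open>z'\<close> next to two coordinates -1. The three edges join opposite vertices of the cycle, so
  the picture is a hexagon with subdivided sides and its three long diagonals: three hexagons
  glued to a Moebius strip. The vertices are distinct as soon as -1, \<open>z\<close>, \<open>z'\<close> are, which uses
  \<open>p \<noteq> 2\<close> and \<open>p \<noteq> 7\<close>.
\<close>

lemma markoff_not_planar_if_sqrt_minus_7:
  assumes "prime p" "odd p" "p \<noteq> 7" "QuadRes (int p) (-7)"
  shows "\<not> planar (markoff_graph (residue_ring (int p)))"
proof -
  let ?G = "markoff_graph (residue_ring (int p))"
  have p1: "1 < p" using prime_gt_1_nat[OF assms(1)] .
  have pp: "prime (int p)" using assms(1) by simp
  have not_dvd: "\<not> int p dvd 2" "\<not> int p dvd 7"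
    using assms primes_dvd_imp_eq[of "int p" 2] primes_dvd_imp_eq[of "int p" 7] by auto
  obtain s where s: "[s^2 = -7] (mod int p)"
    using assms(4) by (auto simp: QuadRes_def)
  \<comment> \<open>\<open>(1 + s) / 2\<close>, with \<open>(1 + p) / 2\<close> as the inverse of 2\<close>
  define z where "z = (1 + s) * ((1 + int p) div 2)"
  define z' where "z' = 1 - z"
  have "2 * ((1 + int p) div 2) = 1 + int p" using assms(2) by simp
  then have "2 * z = (1 + s) * (1 + int p)"
    unfolding z_def by (metis mult.left_commute)
  then have "2 * z - 1 = s + int p * (1 + s)" by (simp add: algebra_simps)
  then have "[(2 * z - 1)^2 = s^2] (mod int p)"
    by (intro cong_pow) (simp add: cong_iff_dvd_diff)
  then have s2: "[(2 * z - 1)^2 = -7] (mod int p)" using s cong_trans by blast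
  have eq: "(2 * z - 1)^2 - (-7) = 2 * 2 * (z^2 - z + 2)"
    by (simp add: power2_eq_square algebra_simps)
  then have "int p dvd 2 * 2 * (z^2 - z + 2)"
    using s2 unfolding cong_iff_dvd_diff eq by blast
  then have zz: "int p dvd z^2 - z + 2"
    using not_dvd(1) prime_dvd_mult_iff[OF pp] by blast
  have ne1: "\<not> int p dvd z + 1"
  proof
    assume "int p dvd z + 1"
    then have "int p dvd (z^2 - z + 2) - (z + 1) * (z - 2)"
      by (rule dvd_diff[OF zz dvd_mult2])
    also have "(z^2 - z + 2) - (z + 1) * (z - 2) = 2 * 2" by (simp add: power2_eq_square algebra_simps)
    finally show False using not_dvd(1) prime_dvd_mult_iff[OF pp] by blast
  qed
  have ne2: "\<not> int p dvd z' + 1"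
  proof
    assume "int p dvd z' + 1"
    then have "int p dvd (z^2 - z + 2) + (z' + 1) * (z + 1)"
      by (rule dvd_add[OF zz dvd_mult2])
    also have "(z^2 - z + 2) + (z' + 1) * (z + 1) = 2 * 2"
      by (simp add: z'_def power2_eq_square algebra_simps)
    finally show False using not_dvd(1) prime_dvd_mult_iff[OF pp] by blast
  qed
  have ne3: "\<not> int p dvd z - z'"
  proof
    assume "int p dvd z - z'"
    then have "[2 * z - 1 = 0] (mod int p)" by (simp add: z'_def cong_iff_dvd_diff)
    then have "[(2 * z - 1)^2 = 0^2] (mod int p)" by (rule cong_pow)
    then have "[-7 = 0] (mod int p)" using s2 by (metis cong_sym cong_trans zero_power2)
    then show False using not_dvd(2) by (simp add: cong_iff_dvd_diff)
  qed
  have ne: "\<not> [z = -1] (mod int p)" "\<not> [-1 = z] (mod int p)" "\<not> [z' = -1] (mod int p)"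
    "\<not> [-1 = z'] (mod int p)" "\<not> [z = z'] (mod int p)" "\<not> [z' = z] (mod int p)"
    using ne1 ne2 ne3 by (auto simp: cong_iff_dvd_diff dvd_diff_commute add.commute)
  \<comment> \<open>neighbours in the list differ by one move, and so do the last and the first entry\<close>
  define c where "c = [(-1, -1, z), (-1, z', z), (-1, z', -1), (z, z', -1), (z, -1, -1), (z, -1, z'),
    (-1, -1, z'), (-1, z, z'), (-1, z, -1), (z', z, -1), (z', -1, -1), (z', -1, z)]"
  define \<phi> where "\<phi> = (\<lambda>k. residue_triple p (c ! k))"
  have "distinct (map (residue_triple p) c)"
    unfolding c_def by (simp add: residue_triple_eq_iff ne)
  moreover have len: "length c = 12" by (simp add: c_def)
  ultimately have "inj_on ((!) (map (residue_triple p) c)) {..<12}"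
    by (intro inj_on_nth) auto
  then have inj: "inj_on \<phi> {..<12}"
    by (simp add: inj_on_def \<phi>_def len)
  have mark: "residue_triple p v \<in> markoff_triples (residue_ring (int p))" if "v \<in> set c" for v
  proof -
    obtain x y w where v: "v = (x, y, w)" by (cases v)
    have "\<not> (int p dvd x \<and> int p dvd y \<and> int p dvd w)"
      using that v p1 by (auto simp: c_def)
    moreover have "\<forall>(x, y, w)\<in>set c. x^2 + y^2 + w^2 - x * y * w = z^2 - z + 2"
      by (simp add: c_def z'_def power2_eq_square algebra_simps)
    then have "x^2 + y^2 + w^2 - x * y * w = z^2 - z + 2"
      using that v by blast
    then have "[x^2 + y^2 + w^2 = x * y * w] (mod int p)"
      using zz by (auto simp: cong_iff_dvd_diff)
    ultimately show ?thesis
      unfolding v by (intro residue_triple_in_markoff_triples p1)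
  qed
  have verts: "\<phi> ` {..<12} \<subseteq> verts ?G"
    unfolding \<phi>_def markoff_graph_def by (auto simp del: split_paired_All intro!: mark nth_mem simp: len)
  have move: "joined ?G (\<phi> k) (\<phi> l)"
    if "k < 12" "l < 12" "k \<noteq> l"
      "case c ! k of (x, y, w) \<Rightarrow> c ! l \<in> {(y * w - x, y, w), (x, x * w - y, w), (x, y, x * y - w)}"
    for k l
  proof -
    obtain x y w where ck: "c ! k = (x, y, w)" by (cases "c ! k")
    have "\<phi> k \<noteq> \<phi> l" using inj that by (auto dest: inj_onD)
    moreover have "c ! k \<in> set c" using that(1) len by simp
    ultimately show ?thesis
      using that(4) mark unfolding \<phi>_def ck by (intro joined_markoff_move p1) auto
  qed
  have rim: "joined ?G (\<phi> 0) (\<phi> 1)" "joined ?G (\<phi> 1) (\<phi> 2)" "joined ?G (\<phi> 2) (\<phi> 3)" "joined ?G (\<phi> 3) (\<phi> 4)"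
    "joined ?G (\<phi> 4) (\<phi> 5)" "joined ?G (\<phi> 5) (\<phi> 6)" "joined ?G (\<phi> 6) (\<phi> 7)" "joined ?G (\<phi> 7) (\<phi> 8)"
    "joined ?G (\<phi> 8) (\<phi> 9)" "joined ?G (\<phi> 9) (\<phi> 10)" "joined ?G (\<phi> 10) (\<phi> 11)" "joined ?G (\<phi> 11) (\<phi> 0)"
    "joined ?G (\<phi> 0) (\<phi> 6)" "joined ?G (\<phi> 2) (\<phi> 8)" "joined ?G (\<phi> 4) (\<phi> 10)"
    by (rule move; simp add: c_def z'_def algebra_simps)+
  note joins = rim rim[THEN joined_sym[THEN iffD1]]
  define P :: "nat \<Rightarrow> nat \<Rightarrow> nat list" where
    "P = (\<lambda>i j. [[[0, 1, 2], [0, 6], [0, 11, 10]],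
                  [[4, 3, 2], [4, 5, 6], [4, 10]],
                  [[8, 2], [8, 7, 6], [8, 9, 10]]] ! i ! j)"
  define a b :: "nat \<Rightarrow> nat" where "a = (!) [0, 4, 8]" and "b = (!) [2, 6, 10]"
  note defs = P_def a_def b_def
  show ?thesis
  proof (rule K33_subdivision_image_not_planar[of "{0, 1, 2}" "{0, 1, 2}" \<phi> "{..<12}" _ P a b])
    show "P i j \<noteq> [] \<and> hd (P i j) = a i \<and> last (P i j) = b j \<and> set (P i j) \<subseteq> {..<12} \<and>
      successively (\<lambda>x y. joined ?G (\<phi> x) (\<phi> y)) (P i j)" if "i \<in> {0, 1, 2}" "j \<in> {0, 1, 2}" for i j
      using that joins unfolding defs by auto
  next
    fix i j i' j' v
    assume "i \<in> {0, 1, 2}" "j \<in> {0, 1, 2}" "i' \<in> {0, 1, 2}" "j' \<in> {0, 1, 2}" "(i, j) \<noteq> (i', j')"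
      "v \<in> set (P i j)" "v \<in> set (P i' j')"
    then show "i = i' \<and> v = a i \<or> j = j' \<and> v = b j"
      unfolding defs by auto
  qed (use inj verts in simp_all)
qed

section \<open>Non-planarity\<close>

theorem corollary1p6:
  fixes p :: nat
  assumes "prime p" and "odd p" and "p \<noteq> 7" and "p mod 28 \<notin> {3, 19, 27}"
  shows "\<not> planar (markoff_graph (residue_ring (int p)))"
proof (cases "p mod 4 = 1")
  case True
  then show ?thesis
    using markoff_not_planar_if_sqrt_minus_1 sqrt_minus_1_mod assms(1,2) by blast
next
  case False
  then have "p mod 4 = 3" using assms(2) by presburger
  then show ?thesis
    using markoff_not_planar_if_sqrt_minus_7 sqrt_minus_7_mod assms by blast
qed

end
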